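(* If $L\leadsto_\theta L'$ and the family $(\sigma_n)_{n\in\mathbb{N}}$ is a solution of $L'$, then $(\theta\circ\sigma_n)_{n\in\mathbb{N}}$ is a solution of $L$.
   Context: Variables range over $\mathbb{Z}$; arithmetic expressions are built from variables, real numbers and operations such as $+,-,\cdot$, division, exponentiation. A limit problem is a finite set of marked expressions $a^\bullet$ with $a$ an arithmetic expression and $\bullet\in\{+,-,+_!,-_!\}$. A function $f:\mathbb{N}\to\mathbb{R}$ satisfies $+$ (resp. $-$) if $\lim_{n\to\infty}f(n)=\infty$ (resp. $-\infty$), and satisfies $+_!$ (resp. $-_!$) if $\lim_{n\to\infty}f(n)=m$ for some real $m>0$ (resp. $m<0$). A family $(\sigma_n)_{n\in\mathbb{N}}$ of integer substitutions whose domains contain all variables of $L$ is a solution of $L$ if for every $a^\bullet\in L$ the function $n\mapsto a\sigma_n$ satisfies $\bullet$. Substitutions are applied homomorphically, $t(\theta\circ\sigma)=t\theta\sigma$, and $L\theta=\{(a\theta)^\bullet\mid a^\bullet\in L\}$. For a binary operation $f:\mathbb{R}\times\mathbb{R}\to\mathbb{R}$, a pair $(\bullet_1,\bullet_2)$ is an increasing (resp. decreasing, positive, negative) limit vector for $f$ if for all $g,h:\mathbb{N}\to\mathbb{R}$ satisfying $\bullet_1$ and $\bullet_2$ respectively, $n\mapsto f(g(n),h(n))$ satisfies $+$ (resp. $-$, $+_!$, $-_!$). The relation $L\leadsto_\theta L'$ is defined by the following rules, where all rules except (C) have $\theta$ the identity substitution: (A) $L\cup\{f(a_1,a_2)^\bullet\}\leadsto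 L\cup\{a_1^{\bullet_1},a_2^{\bullet_2}\}$ if $\bullet$ is $+$ (resp. $-,+_!,-_!$) and $(\bullet_1,\bullet_2)$ is an increasing (resp. decreasing, positive, negative) limit vector for $f$; (B) $L\cup\{m^{+_!}\}\leadsto L$ if $m\in\mathbb{R}$, $m>0$, and $L\cup\{m^{-_!}\}\leadsto L$ if $m\in\mathbb{R}$, $m<0$; (C) $L\leadsto_\theta L\theta$ for a substitution $\theta$ such that $x\notin\mathcal{V}(x\theta)$ for all $x\in\mathrm{dom}(\theta)$ and $\theta\circ\sigma$ is an integer substitution for every integer substitution $\sigma$ whose domain includes all variables occurring in the range of $\theta$; (D) for univariate polynomials $a,b$ over the same variable with the degree of $a$ greater than that of $b$ and $\pm\in\{+,-\}$: $L\cup\{(a\pm b)^+\}\leadsto L\cup\{a^+\}$ and $L\cup\{(a\pm b)^-\}\leadsto L\cup\{a^-\}$; (E) for univariate polynomials $a,b,c$ over the same variable, $\pm\in\{+,-\}$ and $\bullet\in\{+,+_!\}$: $L\cup\{(a^c\pm b)^+\}\leadsto L\cup\{(a-1)^\bullet,c^+\}$. *)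

theory Defs
  imports Complex_Main "HOL-Computational_Algebra.Polynomial"
begin

text \<open>
  The set of arithmetic operations is left open: any binary operation on the reals may
  occur in an expression.
\<close>

datatype 'v expr =
    Var 'v
  | Num real
  | App "real \<Rightarrow> real \<Rightarrow> real" "'v expr" "'v expr"

primrec vars :: "'v expr \<Rightarrow> 'v set" where
  "vars (Var x) = {x}"
| "vars (Num r) = {}"
| "vars (App f a b) = vars a \<union> vars b"

primrec eval :: "('v \<Rightarrow> real) \<Rightarrow> 'v expr \<Rightarrow> real" where
  "eval \<rho> (Var x) = \<rho> x"
| "eval \<rho> (Num r) = r"
| "eval \<rho> (App f a b) = f (eval \<rho> a) (eval \<rho> b)"

text \<open>
  Exponentiation of reals. Plain \<open>powr\<close> does not give the usual value for a non-positive
  base with an integer exponent, e.g. for \<open>x ^ 3\<close> at negative \<open>x\<close>.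
\<close>

definition rpow :: "real \<Rightarrow> real \<Rightarrow> real" where
  "rpow x y = (if y \<in> \<int> then x powi \<lfloor>y\<rfloor> else x powr y)"


type_synonym 'v subst = "'v \<rightharpoonup> 'v expr"

primrec subst :: "'v subst \<Rightarrow> 'v expr \<Rightarrow> 'v expr" where
  "subst \<theta> (Var x) = (case \<theta> x of None \<Rightarrow> Var x | Some t \<Rightarrow> t)"
| "subst \<theta> (Num r) = Num r"
| "subst \<theta> (App f a b) = App f (subst \<theta> a) (subst \<theta> b)"

text \<open>
  Substitutions of numbers for variables are partial functions into the reals. The value of
  \<open>a\<close> under such a \<open>\<sigma>\<close> is meaningful if \<open>vars a \<subseteq> dom \<sigma>\<close>.
\<close>

type_synonym 'v num_subst = "'v \<rightharpoonup> real"

definition integer_subst :: "'v num_subst \<Rightarrow> bool" where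
  "integer_subst \<sigma> \<longleftrightarrow> ran \<sigma> \<subseteq> \<int>"

definition num_value :: "'v num_subst \<Rightarrow> 'v expr \<Rightarrow> real" where
  "num_value \<sigma> a = eval (\<lambda>x. the (\<sigma> x)) a"

text \<open>
  First \<open>\<theta>\<close>, then \<open>\<sigma>\<close>. As for partial functions in general, the composition is defined at
  \<open>x\<close> iff \<open>\<sigma>\<close> is defined on all variables of \<open>x\<theta>\<close>. In particular its domain is
  \<open>dom \<theta> \<union> dom \<sigma>\<close> whenever \<open>\<sigma>\<close> is defined on all variables in the range of \<open>\<theta>\<close>.
\<close>

definition comp_subst :: "'v subst \<Rightarrow> 'v num_subst \<Rightarrow> 'v num_subst" (infixl "\<circ>\<^sub>s" 55) where
  "(\<theta> \<circ>\<^sub>s \<sigma>) x =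
     (let t = subst \<theta> (Var x) in if vars t \<subseteq> dom \<sigma> then Some (num_value \<sigma> t) else None)"

lemma comp_subst_eq_Some:
  "(\<theta> \<circ>\<^sub>s \<sigma>) x = Some r \<longleftrightarrow>
     vars (subst \<theta> (Var x)) \<subseteq> dom \<sigma> \<and> r = num_value \<sigma> (subst \<theta> (Var x))"
  unfolding comp_subst_def Let_def by auto

lemma mem_dom_comp_subst: "x \<in> dom (\<theta> \<circ>\<^sub>s \<sigma>) \<longleftrightarrow> vars (subst \<theta> (Var x)) \<subseteq> dom \<sigma>"
  unfolding dom_def[of "\<theta> \<circ>\<^sub>s \<sigma>"] by (simp add: comp_subst_eq_Some del: subst.simps)

lemma vars_subset_dom_comp_subst:
  "vars t \<subseteq> dom (\<theta> \<circ>\<^sub>s \<sigma>) \<longleftrightarrow> vars (subst \<theta> t) \<subseteq> dom \<sigma>"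
proof (induction t)
  case (Var x)
  then show ?case by (simp add: mem_dom_comp_subst del: subst.simps)
qed simp_all

lemma num_value_comp_subst:
  "vars (subst \<theta> t) \<subseteq> dom \<sigma> \<Longrightarrow> num_value (\<theta> \<circ>\<^sub>s \<sigma>) t = num_value \<sigma> (subst \<theta> t)"
proof (induction t)
  case (Var x)
  then have "(\<theta> \<circ>\<^sub>s \<sigma>) x = Some (num_value \<sigma> (subst \<theta> (Var x)))"
    by (simp only: comp_subst_eq_Some)
  then show ?case by (simp add: num_value_def del: subst.simps)
qed (simp_all add: num_value_def)

lemma dom_comp_subst:
  assumes "(\<Union>t\<in>ran \<theta>. vars t) \<subseteq> dom \<sigma>"
  shows "dom (\<theta> \<circ>\<^sub>s \<sigma>) = dom \<theta> \<union> dom \<sigma>"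
proof (rule set_eqI)
  fix x
  show "x \<in> dom (\<theta> \<circ>\<^sub>s \<sigma>) \<longleftrightarrow> x \<in> dom \<theta> \<union> dom \<sigma>"
  proof (cases "\<theta> x")
    case None
    then have "x \<in> dom (\<theta> \<circ>\<^sub>s \<sigma>) \<longleftrightarrow> x \<in> dom \<sigma>" by (simp add: mem_dom_comp_subst)
    then show ?thesis using None by blast
  next
    case (Some t)
    then have "t \<in> ran \<theta>" by (rule ranI)
    then have "vars t \<subseteq> dom \<sigma>" using assms by blast
    then have "x \<in> dom (\<theta> \<circ>\<^sub>s \<sigma>)" using Some by (simp add: mem_dom_comp_subst)
    then show ?thesis using Some by blast
  qed
qed

lemma empty_comp_subst: "Map.empty \<circ>\<^sub>s \<sigma> = \<sigma>"
proof (rule ext)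
  fix x
  show "(Map.empty \<circ>\<^sub>s \<sigma>) x = \<sigma> x"
    by (cases "\<sigma> x") (simp_all add: comp_subst_def num_value_def domIff)
qed


text \<open>The markings \<open>+\<close>, \<open>-\<close>, \<open>+\<^sub>!\<close>, \<open>-\<^sub>!\<close>, in this order.\<close>

datatype mark = PosInf | NegInf | PosFin | NegFin

fun satisfies :: "(nat \<Rightarrow> real) \<Rightarrow> mark \<Rightarrow> bool" where
  "satisfies f PosInf \<longleftrightarrow> filterlim f at_top sequentially"
| "satisfies f NegInf \<longleftrightarrow> filterlim f at_bot sequentially"
| "satisfies f PosFin \<longleftrightarrow> (\<exists>m>0. f \<longlonglongrightarrow> m)"
| "satisfies f NegFin \<longleftrightarrow> (\<exists>m<0. f \<longlonglongrightarrow> m)"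

type_synonym 'v limit_problem = "('v expr \<times> mark) set"

definition problem_vars :: "'v limit_problem \<Rightarrow> 'v set" where
  "problem_vars L = (\<Union>(a, m)\<in>L. vars a)"

definition subst_problem :: "'v subst \<Rightarrow> 'v limit_problem \<Rightarrow> 'v limit_problem" where
  "subst_problem \<theta> L = (\<lambda>(a, m). (subst \<theta> a, m)) ` L"

definition is_solution :: "(nat \<Rightarrow> 'v num_subst) \<Rightarrow> 'v limit_problem \<Rightarrow> bool" where
  "is_solution \<sigma> L \<longleftrightarrow>
     (\<forall>n. integer_subst (\<sigma> n) \<and> problem_vars L \<subseteq> dom (\<sigma> n)) \<and>
     (\<forall>(a, m)\<in>L. satisfies (\<lambda>n. num_value (\<sigma> n) a) m)"

text \<open>
  For \<open>m\<close> = \<open>PosInf\<close>, \<open>NegInf\<close>, \<open>PosFin\<close>, \<open>NegFin\<close> these are the increasing, decreasing,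
  positive and negative limit vectors, respectively.
\<close>

definition limit_vector :: "mark \<Rightarrow> (real \<Rightarrow> real \<Rightarrow> real) \<Rightarrow> mark \<Rightarrow> mark \<Rightarrow> bool" where
  "limit_vector m f m1 m2 \<longleftrightarrow>
     (\<forall>g h. satisfies g m1 \<longrightarrow> satisfies h m2 \<longrightarrow> satisfies (\<lambda>n. f (g n) (h n)) m)"

text \<open>
  The expression \<open>a\<close> contains no variable other than \<open>x\<close> and denotes the polynomial \<open>p\<close> in \<open>x\<close>
  (constant polynomials are included).
\<close>

definition univariate_poly :: "'v \<Rightarrow> 'v expr \<Rightarrow> real poly \<Rightarrow> bool" where
  "univariate_poly x a p \<longleftrightarrow> vars a \<subseteq> {x} \<and> (\<forall>r. eval (\<lambda>_. r) a = poly p r)"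

inductive limit_step :: "'v limit_problem \<Rightarrow> 'v subst \<Rightarrow> 'v limit_problem \<Rightarrow> bool" where
  A: "limit_vector m f m1 m2 \<Longrightarrow>
      limit_step (L \<union> {(App f a1 a2, m)}) Map.empty (L \<union> {(a1, m1), (a2, m2)})"
| B_pos: "r > 0 \<Longrightarrow> limit_step (L \<union> {(Num r, PosFin)}) Map.empty L"
| B_neg: "r < 0 \<Longrightarrow> limit_step (L \<union> {(Num r, NegFin)}) Map.empty L"
| C: "(\<forall>x\<in>dom \<theta>. x \<notin> vars (subst \<theta> (Var x))) \<Longrightarrow>
      (\<forall>\<sigma>. integer_subst \<sigma> \<longrightarrow> (\<Union>t\<in>ran \<theta>. vars t) \<subseteq> dom \<sigma> \<longrightarrow> integer_subst (\<theta> \<circ>\<^sub>s \<sigma>)) \<Longrightarrow>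
      limit_step L \<theta> (subst_problem \<theta> L)"
| D: "univariate_poly x a p \<Longrightarrow> univariate_poly x b q \<Longrightarrow> degree q < degree p \<Longrightarrow>
      pm \<in> {(+), (-)} \<Longrightarrow> m \<in> {PosInf, NegInf} \<Longrightarrow>
      limit_step (L \<union> {(App pm a b, m)}) Map.empty (L \<union> {(a, m)})"
| E: "univariate_poly x a p \<Longrightarrow> univariate_poly x b q \<Longrightarrow> univariate_poly x c s \<Longrightarrow>
      pm \<in> {(+), (-)} \<Longrightarrow> m \<in> {PosInf, PosFin} \<Longrightarrow>
      limit_step (L \<union> {(App pm (App rpow a c) b, PosInf)}) Map.empty
                 (L \<union> {(App (-) a (Num 1), m), (c, PosInf)})"

end

theory Submission
  imports Defs
    "HOL-Computational_Algebra.Fundamental_Theorem_Algebra"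
    "HOL-Real_Asymp.Real_Asymp"
begin

text \<open>
  Rules (D) and (E) are the analytic ones. Along a solution, a univariate polynomial that tends to
  \<open>\<plusminus>\<infinity>\<close> forces the values of its variable to tend to \<open>\<infinity>\<close> in absolute value, since polynomials are
  bounded on bounded sets. Hence in (D) the polynomial of larger degree dominates. In (E) the exponent
  \<open>c\<close> is a non-constant polynomial, so \<open>b\<close> is dominated by a power \<open>c\<^sup>k\<close>, while the base stays above
  some \<open>d > 1\<close>; it remains to compare \<open>d\<^sup>c\<close> with \<open>c\<^sup>k\<close>.

  Domains need care. In (D) and (E) the right-hand side no longer mentions \<open>b\<close>, but the
  common variable still occurs in the non-constant expression \<open>a\<close> or \<open>c\<close>. In (C) the solution need not
  be defined on all variables in the range of \<open>\<theta>\<close>, so it is extended by \<open>0\<close> first.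
\<close>

section \<open>Expressions as functions of a single variable\<close>

lemma eval_cong:
  "(\<And>x. x \<in> vars a \<Longrightarrow> \<rho> x = \<rho>' x) \<Longrightarrow> eval \<rho> a = eval \<rho>' a"
  by (induction a) auto

lemma num_value_App: "num_value \<sigma> (App f a b) = f (num_value \<sigma> a) (num_value \<sigma> b)"
  by (simp add: num_value_def)

lemma num_value_Num: "num_value \<sigma> (Num r) = r"
  by (simp add: num_value_def)

lemma num_value_univariate_poly:
  assumes "univariate_poly x a p"
  shows "num_value \<sigma> a = poly p (the (\<sigma> x))"
proof -
  have "num_value \<sigma> a = eval (\<lambda>_. the (\<sigma> x)) a"
    unfolding num_value_def using assms by (intro eval_cong) (auto simp: univariate_poly_def)
  then show ?thesis using assms by (simp add: univariate_poly_def)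
qed

text \<open>Without an occurrence of \<open>x\<close>, the value of \<open>a\<close> would not
  depend on the argument, and \<open>p\<close> would agree everywhere with a constant
  polynomial.\<close>

lemma vars_univariate_poly:
  assumes "univariate_poly x a p" and "degree p > 0"
  shows "vars a = {x}"
proof (rule ccontr)
  assume "vars a \<noteq> {x}"
  then have "vars a = {}" using assms by (auto simp: univariate_poly_def)
  then have "eval (\<lambda>_. r) a = eval (\<lambda>_. 0) a" for r by (intro eval_cong) auto
  then have "poly p r = poly [:poly p 0:] r" for r
    using assms by (simp add: univariate_poly_def)
  then have "p = [:poly p 0:]" by (metis poly_eq_poly_eq_iff ext)
  then show False using assms by (metis degree_pCons_0 less_irrefl)
qed

section \<open>Growth of real polynomials\<close>

lemma filterlim_at_infinity_if_poly:
  fixes p :: "real poly"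
  assumes "filterlim (\<lambda>n. poly p (f n)) at_infinity F"
  shows "filterlim f at_infinity F"
  unfolding filterlim_at_infinity[OF order_refl]
proof (intro allI impI)
  fix r :: real
  obtain m where "m > 0" and m: "\<And>z. norm z \<le> r \<Longrightarrow> norm (poly p z) \<le> m"
    using poly_bound_exists[of r p] by blast
  \<comment> \<open>A value of norm at least \<open>m + 1\<close> exceeds the bound
    \<open>m\<close>, which rules out \<open>norm (f n) \<le> r\<close>.\<close>
  have "eventually (\<lambda>n. norm (poly p (f n)) \<ge> m + 1) F"
    using assms \<open>m > 0\<close> by (simp add: filterlim_at_infinity[OF order_refl])
  then show "eventually (\<lambda>n. r \<le> norm (f n)) F"
    by eventually_elim (use m in \<open>smt (verit)\<close>)
qed

lemma degree_pos_if_poly_at_infinity: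
  fixes p :: "real poly"
  assumes "filterlim (\<lambda>n. poly p (f n)) at_infinity F" and "F \<noteq> bot"
  shows "degree p > 0"
proof (rule ccontr)
  assume "\<not> ?thesis"
  then obtain c where "p = [:c:]" by (auto elim: degree_eq_zeroE)
  then have "filterlim (\<lambda>_. c) at_infinity F" using assms by simp
  then show False
    using not_tendsto_and_filterlim_at_infinity[OF assms(2) tendsto_const] by blast
qed

text \<open>The quotient of \<open>q\<close> by \<open>p\<close> tends to 0 at infinity. The factor
  1/2 ensures that adding or subtracting \<open>q\<close> leaves at least half of
  \<open>p\<close>.\<close>

lemma eventually_poly_dominated:
  fixes p q :: "real poly"
  assumes "degree q < degree p" and "filterlim f at_infinity F"
  shows "eventually (\<lambda>n. \<bar>poly q (f n)\<bar> \<le> \<bar>poly p (f n)\<bar> / 2) F"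
proof -
  have "eventually (\<lambda>x. dist (poly q x / poly p x) 0 < 1 / 2) at_infinity"
    using poly_divide_tendsto_0_at_infinity[OF assms(1)] by (rule tendstoD) simp
  \<comment> \<open>Division by 0 yields 0, so a small quotient bounds the numerator only where
    \<open>p\<close> does not vanish.\<close>
  moreover have "eventually (\<lambda>x. poly p x \<noteq> 0) at_infinity"
    using assms by (intro poly_eventually_not_zero) auto
  ultimately have "eventually (\<lambda>x. \<bar>poly q x\<bar> \<le> \<bar>poly p x\<bar> / 2) at_infinity"
    by eventually_elim (simp add: field_simps)
  then show ?thesis using assms(2) by (rule eventually_compose_filterlim)
qed

lemma rpow_eq_powr: "x > 0 \<Longrightarrow> rpow x y = x powr y"
  by (auto simp: rpow_def elim!: Ints_cases simp flip: powr_real_of_int')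

text \<open>The sign of \<open>f\<close> is eventually fixed, so \<open>f n / 2\<close> bounds the
  sum from below, or from above when \<open>f\<close> tends to minus infinity; the latter case is
  reduced to the former by negation.\<close>

lemma satisfies_add_dominated:
  assumes "satisfies f m" and "m \<in> {PosInf, NegInf}"
    and "eventually (\<lambda>n. \<bar>g n\<bar> \<le> \<bar>f n\<bar> / 2) sequentially"
  shows "satisfies (\<lambda>n. f n + g n) m"
proof (cases m)
  case PosInf
  then have f: "filterlim f at_top sequentially" using assms by simp
  then have "eventually (\<lambda>n. f n \<ge> 0) sequentially" by (simp add: filterlim_at_top)
  with assms(3) have "eventually (\<lambda>n. f n * (1/2) \<le> f n + g n) sequentially"
    by eventually_elim auto
  moreover have "filterlim (\<lambda>n. f n * (1/2)) at_top sequentially"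
    using f by (intro filterlim_at_top_mult_tendsto_pos[OF tendsto_const]) auto
  ultimately show ?thesis using PosInf by (auto intro: filterlim_at_top_mono)
next
  case NegInf
  then have f: "filterlim (\<lambda>n. - f n) at_top sequentially"
    using assms by (simp add: filterlim_uminus_at_top)
  then have "eventually (\<lambda>n. - f n \<ge> 0) sequentially" by (simp only: filterlim_at_top)
  with assms(3) have "eventually (\<lambda>n. - f n * (1/2) \<le> - (f n + g n)) sequentially"
    by eventually_elim auto
  moreover have "filterlim (\<lambda>n. - f n * (1/2)) at_top sequentially"
    using f by (intro filterlim_at_top_mult_tendsto_pos[OF tendsto_const]) auto
  ultimately have "filterlim (\<lambda>n. - (f n + g n)) at_top sequentially"
    by (rule filterlim_at_top_mono[rotated])
  then show ?thesis using NegInf by (simp add: filterlim_uminus_at_top add.commute)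
qed (use assms in auto)

lemma satisfies_imp_at_infinity:
  "satisfies f m \<Longrightarrow> m \<in> {PosInf, NegInf} \<Longrightarrow> filterlim f at_infinity sequentially"
  by (auto intro: filterlim_at_top_imp_at_infinity filterlim_at_bot_imp_at_infinity)

lemma satisfies_poly_pm:
  fixes p q :: "real poly"
  assumes "satisfies (\<lambda>n. poly p (f n)) m" and "m \<in> {PosInf, NegInf}"
    and "degree q < degree p" and "pm \<in> {(+), (-)}"
  shows "satisfies (\<lambda>n. pm (poly p (f n)) (poly q (f n))) m"
proof -
  have "filterlim f at_infinity sequentially"
    using satisfies_imp_at_infinity[OF assms(1,2)] by (rule filterlim_at_infinity_if_poly)
  then have *: "eventually (\<lambda>n. \<bar>poly q (f n)\<bar> \<le> \<bar>poly p (f n)\<bar> / 2) sequentially"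
    using assms(3) by (rule eventually_poly_dominated[rotated])
  \<comment> \<open>Subtraction is handled as addition of \<open>- q\<close>, which has the same
    absolute value.\<close>
  then have "eventually (\<lambda>n. \<bar>- poly q (f n)\<bar> \<le> \<bar>poly p (f n)\<bar> / 2) sequentially" by simp
  from satisfies_add_dominated[OF assms(1,2) *] satisfies_add_dominated[OF assms(1,2) this]
  show ?thesis using assms(4) by auto
qed

section \<open>Exponential growth against polynomials\<close>

lemma eventually_base_gt_1:
  assumes "satisfies (\<lambda>n. a n - 1) m" and "m \<in> {PosInf, PosFin}"
  obtains d where "d > 1" and "eventually (\<lambda>n. a n \<ge> d) sequentially"
proof (cases m)
  case PosInf
  then have "filterlim (\<lambda>n. a n - 1) at_top sequentially" using assms by simp
  then have "eventually (\<lambda>n. a n - 1 \<ge> 1) sequentially" by (simp only: filterlim_at_top)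
  then have "eventually (\<lambda>n. a n \<ge> 2) sequentially" by eventually_elim simp
  then show ?thesis using that[of 2] by simp
next
  case PosFin
  then obtain l where l: "l > 0" "(\<lambda>n. a n - 1) \<longlonglongrightarrow> l" using assms by auto
  \<comment> \<open>Half the limit leaves a margin that does not depend on \<open>n\<close>.\<close>
  then have "eventually (\<lambda>n. a n - 1 > l / 2) sequentially" by (intro order_tendstoD) auto
  then have "eventually (\<lambda>n. a n \<ge> 1 + l / 2) sequentially" by eventually_elim simp
  then show ?thesis using that[of "1 + l / 2"] l by simp
qed (use assms in auto)

lemma filterlim_powr_minus_power_at_top:
  fixes d :: real
  assumes "d > 1"
  shows "filterlim (\<lambda>x. d powr x - x ^ k) at_top at_top"
  using assms by real_asymp

lemma filterlim_rpow_pm_poly: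
  fixes q s :: "real poly"
  assumes "satisfies (\<lambda>n. a n - 1) m" and "m \<in> {PosInf, PosFin}"
    and s: "filterlim (\<lambda>n. poly s (f n)) at_top sequentially" and "pm \<in> {(+), (-)}"
  shows "filterlim (\<lambda>n. pm (rpow (a n) (poly s (f n))) (poly q (f n))) at_top sequentially"
proof -
  obtain d where d: "d > 1" "eventually (\<lambda>n. a n \<ge> d) sequentially"
    using eventually_base_gt_1[OF assms(1,2)] by blast
  \<comment> \<open>Since \<open>degree s\<close> is at least 1, this exponent gives
    \<open>s ^ ?k\<close> degree greater than \<open>degree q\<close>.\<close>
  let ?k = "Suc (degree q)"
  have inf: "filterlim (\<lambda>n. poly s (f n)) at_infinity sequentially"
    using s by (rule filterlim_at_top_imp_at_infinity)
  have "degree s > 0" using inf by (rule degree_pos_if_poly_at_infinity) simp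
  then have "degree q < ?k * degree s" by (cases "degree s") auto
  also have "\<dots> = degree (s ^ ?k)" using \<open>degree s > 0\<close> by (intro degree_power_eq[symmetric]) auto
  finally have "degree q < degree (s ^ ?k)" .
  then have "eventually (\<lambda>n. \<bar>poly q (f n)\<bar> \<le> \<bar>poly (s ^ ?k) (f n)\<bar> / 2) sequentially"
    using filterlim_at_infinity_if_poly[OF inf] by (rule eventually_poly_dominated)
  moreover have "eventually (\<lambda>n. poly s (f n) \<ge> 0) sequentially"
    using s by (simp add: filterlim_at_top)
  \<comment> \<open>The lower bound depends on \<open>n\<close> only through
    \<open>poly s (f n)\<close>, so the one-variable limit can be composed with \<open>s\<close>.
    Nonnegativity of the exponent makes \<open>powr\<close> monotone in the base.\<close>
  ultimately have "eventually (\<lambda>n. d powr poly s (f n) - poly s (f n) ^ ?k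
      \<le> pm (rpow (a n) (poly s (f n))) (poly q (f n))) sequentially"
    using d(2)
  proof eventually_elim
    case (elim n)
    then have "d powr poly s (f n) \<le> rpow (a n) (poly s (f n))"
      using d(1) by (simp add: rpow_eq_powr powr_mono2)
    moreover have "\<bar>poly q (f n)\<bar> \<le> poly s (f n) ^ ?k"
    proof -
      have "poly s (f n) ^ ?k \<ge> 0" using elim by simp
      moreover have "\<bar>poly q (f n)\<bar> \<le> \<bar>poly s (f n) ^ ?k\<bar> / 2"
        using elim(1) by (simp only: poly_power)
      ultimately show ?thesis by linarith
    qed
    ultimately show ?case using assms(4) by auto
  qed
  moreover have "filterlim (\<lambda>n. d powr poly s (f n) - poly s (f n) ^ ?k) at_top sequentially"
    using filterlim_compose[OF filterlim_powr_minus_power_at_top[OF d(1)] s] .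
  ultimately show ?thesis by (rule filterlim_at_top_mono[rotated])
qed

section \<open>Composition of substitutions\<close>

lemma integer_subst_comp_subst:
  assumes "\<forall>\<sigma>. integer_subst \<sigma> \<longrightarrow> (\<Union>t\<in>ran \<theta>. vars t) \<subseteq> dom \<sigma> \<longrightarrow> integer_subst (\<theta> \<circ>\<^sub>s \<sigma>)"
    and "integer_subst \<sigma>"
  shows "integer_subst (\<theta> \<circ>\<^sub>s \<sigma>)"
proof -
  \<comment> \<open>The default 0 is an integer, so the extension is again an integer substitution,
    now total.\<close>
  define \<sigma>' where "\<sigma>' = (\<lambda>x. case \<sigma> x of None \<Rightarrow> Some 0 | Some r \<Rightarrow> Some r)"
  have "dom \<sigma>' = UNIV" by (auto simp: \<sigma>'_def dom_def split: option.splits)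
  moreover have "integer_subst \<sigma>'"
    using assms(2) by (auto simp: \<sigma>'_def integer_subst_def ran_def split: option.splits)
  ultimately have int: "integer_subst (\<theta> \<circ>\<^sub>s \<sigma>')" using assms(1) by simp
  \<comment> \<open>Extending \<sigma> preserves the values already defined, so the range of the
    original composition lies in that of the extended one.\<close>
  have "(\<theta> \<circ>\<^sub>s \<sigma>') x = Some r" if "(\<theta> \<circ>\<^sub>s \<sigma>) x = Some r" for x r
  proof -
    have *: "vars (subst \<theta> (Var x)) \<subseteq> dom \<sigma>" "r = num_value \<sigma> (subst \<theta> (Var x))"
      using that unfolding comp_subst_eq_Some by auto
    have "num_value \<sigma> (subst \<theta> (Var x)) = num_value \<sigma>' (subst \<theta> (Var x))"
      unfolding num_value_def
      by (rule eval_cong) (use *(1) in \<open>force simp: \<sigma>'_def simp del: subst.simps\<close>)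
    then show ?thesis
      using * \<open>dom \<sigma>' = UNIV\<close> unfolding comp_subst_eq_Some by simp
  qed
  then have "ran (\<theta> \<circ>\<^sub>s \<sigma>) \<subseteq> ran (\<theta> \<circ>\<^sub>s \<sigma>')" by (auto simp: ran_def)
  then show ?thesis using int by (auto simp: integer_subst_def)
qed

lemma is_solution_subst_problem:
  assumes "is_solution \<sigma> (subst_problem \<theta> L)" and "\<And>n. integer_subst (\<theta> \<circ>\<^sub>s \<sigma> n)"
  shows "is_solution (\<lambda>n. \<theta> \<circ>\<^sub>s \<sigma> n) L"
proof -
  have mem: "(subst \<theta> a, m) \<in> subst_problem \<theta> L" if "(a, m) \<in> L" for a m
    using imageI[OF that, of "\<lambda>(a, m). (subst \<theta> a, m)"] by (simp add: subst_problem_def)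
  have dom: "vars (subst \<theta> a) \<subseteq> dom (\<sigma> n)" if "(a, m) \<in> L" for a m n
  proof -
    have "vars (subst \<theta> a) \<subseteq> problem_vars (subst_problem \<theta> L)"
      using mem[OF that] by (auto simp: problem_vars_def)
    also have "\<dots> \<subseteq> dom (\<sigma> n)" using assms(1) by (simp add: is_solution_def)
    finally show ?thesis .
  qed
  then have "vars a \<subseteq> dom (\<theta> \<circ>\<^sub>s \<sigma> n)" if "(a, m) \<in> L" for a m n
    using that by (simp only: vars_subset_dom_comp_subst)
  then have "problem_vars L \<subseteq> dom (\<theta> \<circ>\<^sub>s \<sigma> n)" for n
    unfolding problem_vars_def by blast
  moreover have "satisfies (\<lambda>n. num_value (\<theta> \<circ>\<^sub>s \<sigma> n) a) m" if "(a, m) \<in> L" for a m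
  proof -
    have "satisfies (\<lambda>n. num_value (\<sigma> n) (subst \<theta> a)) m"
      using assms(1) mem[OF that] unfolding is_solution_def by blast
    then show ?thesis by (simp only: num_value_comp_subst[OF dom[OF that]])
  qed
  ultimately show ?thesis using assms(2) by (auto simp: is_solution_def)
qed

section \<open>Soundness of the individual rules\<close>

lemma problem_vars_Un: "problem_vars (L \<union> M) = problem_vars L \<union> problem_vars M"
  by (auto simp: problem_vars_def)

lemma problem_vars_insert: "problem_vars (insert (a, m) L) = vars a \<union> problem_vars L"
  by (auto simp: problem_vars_def)

lemma problem_vars_empty: "problem_vars {} = {}"
  by (simp add: problem_vars_def)

lemmas is_solution_simps =
  is_solution_def problem_vars_Un problem_vars_insert problem_vars_empty ball_Un

theorem theorem5p20:
  fixes L L' :: "'v limit_problem" and \<theta> :: "'v subst" and \<sigma> :: "nat \<Rightarrow> 'v num_subst"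
  assumes "finite L"
    and "limit_step L \<theta> L'"
    and "is_solution \<sigma> L'"
  shows "is_solution (\<lambda>n. \<theta> \<circ>\<^sub>s \<sigma> n) L"
  using assms(2)
proof cases
  case (A m f m1 m2 L\<^sub>0 a1 a2)
  then show ?thesis
    using assms(3) by (auto simp: is_solution_simps empty_comp_subst num_value_App limit_vector_def)
next
  case (B_pos r)
  then show ?thesis
    using assms(3) by (auto simp: is_solution_simps empty_comp_subst num_value_Num)
next
  case (B_neg r)
  then show ?thesis
    using assms(3) by (auto simp: is_solution_simps empty_comp_subst num_value_Num)
next
  case C
  have "integer_subst (\<theta> \<circ>\<^sub>s \<sigma> n)" for n
    using integer_subst_comp_subst[OF C(3)] assms(3) by (simp add: is_solution_def)
  then show ?thesis using assms(3) C(1) by (intro is_solution_subst_problem) auto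
next
  case (D x a p b q pm m L\<^sub>0)
  have a: "satisfies (\<lambda>n. poly p (the (\<sigma> n x))) m"
    using assms(3) D by (auto simp: is_solution_simps num_value_univariate_poly)
  have "satisfies (\<lambda>n. num_value (\<sigma> n) (App pm a b)) m"
    using satisfies_poly_pm[OF a] D by (simp add: num_value_App num_value_univariate_poly)
  moreover have "vars b \<subseteq> vars a"
    using vars_univariate_poly[OF D(4)] D(5,6) by (auto simp: univariate_poly_def)
  ultimately show ?thesis
    using assms(3) D(1-3) by (auto simp: is_solution_simps empty_comp_subst)
next
  case (E x a p b q c s pm m L\<^sub>0)
  have a: "satisfies (\<lambda>n. num_value (\<sigma> n) a - 1) m"
    and c: "filterlim (\<lambda>n. poly s (the (\<sigma> n x))) at_top sequentially"
    using assms(3) E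
    by (auto simp: is_solution_simps num_value_App num_value_Num num_value_univariate_poly)
  have "satisfies (\<lambda>n. num_value (\<sigma> n) (App pm (App rpow a c) b)) PosInf"
    using filterlim_rpow_pm_poly[OF a E(8) c E(7)]
    by (simp add: num_value_App num_value_univariate_poly[OF E(5)] num_value_univariate_poly[OF E(6)])
  \<comment> \<open>Here non-constancy comes from the limit of \<open>c\<close>, whereas in (D) it
    follows from the degree condition.\<close>
  moreover have "degree s > 0"
    using filterlim_at_top_imp_at_infinity[OF c] by (rule degree_pos_if_poly_at_infinity) simp
  then have "vars b \<subseteq> vars c"
    using vars_univariate_poly[OF E(6)] E(5) by (auto simp: univariate_poly_def)
  ultimately show ?thesis
    using assms(3) E(1-3) by (auto simp: is_solution_simps empty_comp_subst)
qed

end
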